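(* Let $f,g$ be two functions defined on $\mathbb{Z}_{\ge0}^N\times\mathbb{Z}_{\ge0}$, and let $\alpha$ be a function on the positive integers $\mathbb{Z}_{+}$ such that $\alpha(n)\alpha(m)=\alpha(nm)$. If $$\sum_{n\mid\Sigma}\alpha(n)\,f\!\left(\tfrac{\Sigma}{n},nm\right)=g(\Sigma,m)$$ holds for any $\Sigma\in\mathbb{Z}_{\ge0}^N$ and $m\in\mathbb{Z}_{\ge0}$, then $$f(\Sigma,m)=\sum_{n\mid\Sigma}\mu(n)\,\alpha(n)\,g\!\left(\tfrac{\Sigma}{n},nm\right).$$
   Context: For $\Sigma=(k_1,\dots,k_N)\in\mathbb{Z}^N_{\ge0}$ and a positive integer $n$, $n\mid\Sigma$ means that $n\mid k_i$ for all $1\le i\le N$, and $\Sigma/n=(k_1/n,\dots,k_N/n)$. Sums over $n\mid\Sigma$ run over positive integers $n$ dividing $\Sigma$. $\mu$ is the Möbius function: $\mu(n)=(-1)^r$ if $n$ is a product of $r$ distinct primes (so $\mu(1)=1$), and $\mu(n)=0$ otherwise.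
   Formalization: Adds α(1)=1 (for α=0, g=0 the claim fails) and, since every n divides Σ=0, assumes the sum in the hypothesis at Σ=0 has only finitely many nonzero terms; f, g, α take values in a commutative ring with 1. *)

theory Defs
  imports "HOL-Analysis.Analysis" "HOL-Computational_Algebra.Primes"
begin

text \<open>
  The first condition says that \<open>n\<close> is the product of its distinct prime divisors, that is, a
  product of distinct primes. It fails for \<open>n = 0\<close>, where the set of prime factors is empty and
  the product is \<open>1\<close>.
\<close>

definition moebius_mu :: "nat \<Rightarrow> int" where
  "moebius_mu n =
     (if n = \<Prod>(prime_factors n) then (-1) ^ card (prime_factors n) else 0)"

lemma moebius_prod_primes:
  assumes "finite P" and "\<And>p. p \<in> P \<Longrightarrow> prime p"
  shows "moebius_mu (\<Prod>P) = (-1) ^ card P"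
proof -
  have "prime_factors (\<Prod>P) = P"
    using assms
  proof (induction P rule: finite_induct)
    case (insert p P)
    have "q \<noteq> 0" if "q \<in> insert p P" for q
      using insert.prems[OF that] by (metis not_prime_0)
    then have "\<Prod>P \<noteq> 0" "p \<noteq> 0"
      using insert.hyps by auto
    moreover have "prime_factors p = {p}"
      using insert.prems by (simp add: prime_factorization_prime)
    ultimately show ?case
      using insert by (simp add: prime_factors_product)
  qed simp
  then show ?thesis
    by (simp add: moebius_mu_def)
qed

lemma moebius_not_prod_primes:
  assumes "\<nexists>P. finite P \<and> (\<forall>p\<in>P. prime p) \<and> n = \<Prod>P"
  shows "moebius_mu n = 0"
  using assms unfolding moebius_mu_def by (metis finite_set_mset in_prime_factors_iff)

text \<open>
  For \<open>k \<noteq> 0\<close> the set \<open>pos_divisors k\<close> is finite; for \<open>k = 0\<close> it consists of all positive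
  integers. Sums over it are therefore written with \<open>sum'\<close>, which adds up the finitely many
  nonzero terms (and is a dummy \<open>0\<close> if there are infinitely many).
\<close>

definition pos_divisors :: "nat ^ 'n \<Rightarrow> nat set" where
  "pos_divisors k = {n. n > 0 \<and> (\<forall>i. n dvd k $ i)}"

definition vec_div :: "nat ^ 'n \<Rightarrow> nat \<Rightarrow> nat ^ 'n" where
  "vec_div k n = (\<chi> i. k $ i div n)"

end

theory Submission
  imports Defs
begin

text \<open>
  Fix \<open>k\<close> and \<open>m\<close> and let \<open>S\<close> be the finite set of those \<open>l\<close> whose term
  \<open>h l = \<alpha> l * f (k/l) (l*m)\<close> is nonzero. Multiplicativity of \<open>\<alpha>\<close> turns \<open>\<alpha> n * g (k/n) (n*m)\<close> into
  the sum of \<open>h l\<close> over the multiples \<open>l \<in> S\<close> of \<open>n\<close>. So only divisors \<open>n\<close> of elements of \<open>S\<close>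
  contribute, which makes the sum finite even for \<open>k = 0\<close>, and exchanging the summations leaves
  the coefficient \<open>\<Sum>n | n dvd l. \<mu> n\<close> for \<open>h l\<close>, which vanishes unless \<open>l = 1\<close>.
\<close>

text \<open>The product is the radical of \<open>n\<close>: as a multiset, the distinct primes are
  contained in the full prime factorization.\<close>

lemma prod_prime_factors_dvd:
  fixes n :: nat
  assumes "n \<noteq> 0"
  shows "\<Prod>(prime_factors n) dvd n"
proof -
  have "mset_set (prime_factors n) \<subseteq># prime_factorization n"
    by (rule mset_set_set_mset_msubset)
  then have "prod_mset (mset_set (prime_factors n)) dvd prod_mset (prime_factorization n)"
    by (rule prod_mset_subset_imp_dvd)
  then show ?thesis
    using assms by (simp add: prod_unfold_prod_mset prod_mset_prime_factorization)
qed

lemma prime_factors_prod_primes: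
  fixes P :: "nat set"
  assumes "finite P" "\<And>p. p \<in> P \<Longrightarrow> prime p"
  shows "prime_factors (\<Prod>P) = P"
proof -
  have "\<Prod>P \<noteq> 0"
    using assms by (metis not_prime_0 prod_zero_iff)
  moreover have "p dvd \<Prod>P \<longleftrightarrow> p \<in> P" if "prime p" for p
    using that assms by (metis dvd_refl prime_dvd_prod_iff primes_dvd_imp_eq)
  ultimately show ?thesis
    using assms by (auto simp: prime_factors_dvd)
qed

text \<open>Only the squarefree divisors count. They correspond to the subsets of
  \<open>prime_factors n\<close>, so the sum is the expansion of a product of factors
  \<open>1 - 1\<close>, one for each prime; this is empty exactly for \<open>n = 1\<close>.\<close>

lemma sum_moebius_mu:
  assumes "n > 0"
  shows "(\<Sum>d | d dvd n. moebius_mu d) = (if n = 1 then 1 else 0)"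
proof -
  let ?A = "prime_factors n"
  have primes: "prime p" if "P \<subseteq> ?A" "p \<in> P" for P p
    using that by auto
  have fin: "finite P" if "P \<subseteq> ?A" for P
    using that finite_subset by blast
  have pf: "prime_factors (\<Prod>P) = P" if "P \<subseteq> ?A" for P
    using fin primes that by (intro prime_factors_prod_primes) auto
  \<comment> \<open>By \<open>pf\<close>, taking prime factors is a left inverse of
    \<open>Prod\<close> here.\<close>
  have "inj_on Prod (Pow ?A)"
    using pf by (intro inj_on_inverseI[where g = prime_factors]) auto
  have sub: "Prod ` Pow ?A \<subseteq> {d. d dvd n}"
  proof clarify
    fix P assume "P \<subseteq> ?A"
    then have "\<Prod>P dvd \<Prod>?A"
      by (intro prod_dvd_prod_subset) auto
    also have "\<dots> dvd n"
      using assms by (intro prod_prime_factors_dvd) simp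
    finally show "\<Prod>P dvd n" .
  qed
  have zero: "moebius_mu d = 0" if "d dvd n" "d \<notin> Prod ` Pow ?A" for d
  proof -
    have "prime_factors d \<subseteq> ?A"
      using that assms by (intro dvd_prime_factors) auto
    with that have "d \<noteq> \<Prod>(prime_factors d)"
      by blast
    then show ?thesis
      by (simp add: moebius_mu_def)
  qed
  have "(\<Sum>d | d dvd n. moebius_mu d) = (\<Sum>d\<in>Prod ` Pow ?A. moebius_mu d)"
    using assms sub zero by (intro sum.mono_neutral_right) auto
  also have "\<dots> = (\<Sum>P\<in>Pow ?A. moebius_mu (\<Prod>P))"
    using \<open>inj_on Prod (Pow ?A)\<close> by (simp add: sum.reindex)
  also have "\<dots> = (\<Sum>P\<in>Pow ?A. (-1) ^ card P)"
    by (intro sum.cong refl moebius_prod_primes) (auto intro: fin)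
  also have "\<dots> = (\<Prod>p\<in>?A. 1 - 1)"
    by (subst prod_diff_conv_sum) simp_all
  also have "\<dots> = (if n = 1 then 1 else 0)"
    using assms by (auto simp: prime_factorization_empty_iff card_gt_0_iff)
  finally show ?thesis .
qed

lemma sum'_eq_sum:
  assumes "finite S" "S \<subseteq> A" "\<And>x. x \<in> A - S \<Longrightarrow> h x = 0"
  shows "sum' h A = sum h S"
  using assms by (metis sum.eq_sum sum.mono_neutral_left')

lemma finite_pos_divisors:
  fixes k :: "nat ^ 'n"
  assumes "k \<noteq> 0"
  shows "finite (pos_divisors k)"
proof -
  obtain i where "k $ i \<noteq> 0"
    using assms by (auto simp: vec_eq_iff)
  moreover have "pos_divisors k \<subseteq> {n. n dvd k $ i}"
    by (auto simp: pos_divisors_def)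
  ultimately show ?thesis
    by (auto intro: finite_subset)
qed

lemma vec_div_vec_div: "vec_div (vec_div k a) b = vec_div k (a * b)"
  by (simp add: vec_div_def vec_eq_iff div_mult2_eq)

lemma vec_div_one: "vec_div k 1 = k"
  by (simp add: vec_div_def vec_eq_iff)

text \<open>This lets \<open>j\<close> be replaced by \<open>l = n * j\<close>, which runs over the
  common divisors of \<open>k\<close> that are multiples of \<open>n\<close>.\<close>

lemma mem_pos_divisors_vec_div_iff:
  assumes "n \<in> pos_divisors k"
  shows "j \<in> pos_divisors (vec_div k n) \<longleftrightarrow> n * j \<in> pos_divisors k"
  using assms by (auto simp: pos_divisors_def vec_div_def dvd_div_iff_mult mult.commute)

text \<open>The hypothesis \<open>one\<close> excludes \<open>\<alpha> = 0\<close>, which is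
  multiplicative but forces \<open>g = 0\<close> for every \<open>f\<close>. Finiteness is a
  condition only at the zero vector, where the sum runs over all positive integers.\<close>

theorem theorem4p1:
  fixes f g :: "nat ^ 'n \<Rightarrow> nat \<Rightarrow> 'a :: comm_ring_1"
    and \<alpha> :: "nat \<Rightarrow> 'a"
  assumes mult: "\<And>n m. n > 0 \<Longrightarrow> m > 0 \<Longrightarrow> \<alpha> n * \<alpha> m = \<alpha> (n * m)"
    and one: "\<alpha> 1 = 1"
    and fin: "\<And>m. finite {n \<in> pos_divisors (0 :: nat ^ 'n). \<alpha> n * f (vec_div 0 n) (n * m) \<noteq> 0}"
    and eq: "\<And>k m. sum' (\<lambda>n. \<alpha> n * f (vec_div k n) (n * m)) (pos_divisors k) = g k m"
  shows "\<forall>k m. f k m =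
    sum' (\<lambda>n. of_int (moebius_mu n) * \<alpha> n * g (vec_div k n) (n * m)) (pos_divisors k)"
proof (intro allI)
  fix k :: "nat ^ 'n" and m :: nat
  define supp where "supp k m = {n \<in> pos_divisors k. \<alpha> n * f (vec_div k n) (n * m) \<noteq> 0}"
    for k :: "nat ^ 'n" and m
  have finite_supp: "finite (supp k m)" for k m
    unfolding supp_def using fin[of m] finite_pos_divisors[of k]
    by (cases "k = 0") auto
  \<comment> \<open>Kept general in \<open>k\<close> and \<open>m\<close>, since it is applied at
    \<open>vec_div k n\<close> and \<open>n * m\<close>.\<close>
  have g_eq: "g k m = (\<Sum>n\<in>supp k m. \<alpha> n * f (vec_div k n) (n * m))" for k m
    unfolding eq[symmetric] by (intro sum'_eq_sum finite_supp) (auto simp: supp_def)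
  define h where "h l = \<alpha> l * f (vec_div k l) (l * m)" for l
  define S where "S = supp k m"
  have S: "finite S" "S = {l \<in> pos_divisors k. h l \<noteq> 0}"
    using finite_supp by (auto simp: S_def supp_def h_def)
  have term_eq: "\<alpha> n * g (vec_div k n) (n * m) = (\<Sum>l | l \<in> S \<and> n dvd l. h l)"
    if n: "n \<in> pos_divisors k" for n
  proof -
    have "n > 0"
      using n by (simp add: pos_divisors_def)
    define T where "T = supp (vec_div k n) (n * m)"
    have T: "T \<subseteq> pos_divisors (vec_div k n)"
      by (auto simp: T_def supp_def)
    have h_mult: "\<alpha> n * (\<alpha> j * f (vec_div (vec_div k n) j) (j * (n * m))) = h (n * j)"
      if "j \<in> pos_divisors (vec_div k n)" for j
    proof -
      have "j > 0"
        using that by (simp add: pos_divisors_def)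
      have "j * (n * m) = n * j * m"
        by simp
      with mult[OF \<open>n > 0\<close> \<open>j > 0\<close>] show ?thesis
        by (metis h_def mult.assoc vec_div_vec_div)
    qed
    have "\<alpha> n * g (vec_div k n) (n * m) = (\<Sum>j\<in>T. h (n * j))"
      unfolding g_eq sum_distrib_left T_def[symmetric]
      using T by (intro sum.cong refl h_mult) auto
    also have "\<dots> = sum h ((*) n ` T)"
      using \<open>n > 0\<close> by (subst sum.reindex) (auto simp: inj_on_def)
    also have "\<dots> = (\<Sum>l | l \<in> S \<and> n dvd l. h l)"
    \<comment> \<open>The image of \<open>T\<close> may exceed the multiples of \<open>n\<close> in
      \<open>S\<close>, because multiplication by \<open>\<alpha> n\<close> can annihilate a nonzero
      term; at such extra points \<open>h\<close> vanishes.\<close>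
    proof (rule sum.mono_neutral_right)
      show "finite ((*) n ` T)"
        unfolding T_def using finite_supp by simp
      show "{l. l \<in> S \<and> n dvd l} \<subseteq> (*) n ` T"
      proof
        fix l assume "l \<in> {l. l \<in> S \<and> n dvd l}"
        then obtain j where l: "l = n * j" "n * j \<in> S"
          by auto
        then have j: "j \<in> pos_divisors (vec_div k n)" "h (n * j) \<noteq> 0"
          using S mem_pos_divisors_vec_div_iff[OF n] by auto
        then have "j \<in> T"
          unfolding T_def supp_def using h_mult by fastforce
        then show "l \<in> (*) n ` T"
          unfolding l(1) by (rule imageI)
      qed
      show "\<forall>l\<in>(*) n ` T - {l. l \<in> S \<and> n dvd l}. h l = 0"
        using T S mem_pos_divisors_vec_div_iff[OF n] by auto
    qed
    finally show ?thesis .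
  qed
  \<comment> \<open>Outside \<open>D\<close> the inner sum is empty. \<open>D\<close> is finite
    because \<open>S\<close> is finite and its elements are positive.\<close>
  define D where "D = (\<Union>l\<in>S. {d. d dvd l})"
  have S_pos: "l > 0" if "l \<in> S" for l
    using that S by (simp add: pos_divisors_def)
  have D: "finite D" "D \<subseteq> pos_divisors k"
  proof -
    show "finite D"
      using S(1) S_pos by (auto simp: D_def)
    show "D \<subseteq> pos_divisors k"
    proof
      fix d assume "d \<in> D"
      then obtain l where l: "l \<in> S" "d dvd l"
        by (auto simp: D_def)
      then have "l \<in> pos_divisors k" "d > 0"
        using S S_pos dvd_pos_nat by auto
      then show "d \<in> pos_divisors k"
        using l(2) dvd_trans unfolding pos_divisors_def by blast
    qed
  qed
  have "sum' (\<lambda>n. of_int (moebius_mu n) * \<alpha> n * g (vec_div k n) (n * m)) (pos_divisors k)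
      = sum' (\<lambda>n. of_int (moebius_mu n) * (\<Sum>l | l \<in> S \<and> n dvd l. h l)) (pos_divisors k)"
    by (intro sum.cong') (simp_all add: mult.assoc term_eq)
  also have "\<dots> = (\<Sum>n\<in>D. of_int (moebius_mu n) * (\<Sum>l | l \<in> S \<and> n dvd l. h l))"
  proof (rule sum'_eq_sum[OF D])
    fix n assume "n \<in> pos_divisors k - D"
    then have "{l. l \<in> S \<and> n dvd l} = {}"
      by (auto simp: D_def)
    then show "of_int (moebius_mu n) * (\<Sum>l | l \<in> S \<and> n dvd l. h l) = 0"
      by (metis mult_zero_right sum.empty)
  qed
  also have "\<dots> = (\<Sum>l\<in>S. \<Sum>n | n \<in> D \<and> n dvd l. of_int (moebius_mu n) * h l)"
    unfolding sum_distrib_left by (rule sum.swap_restrict[OF D(1) S(1)])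
  also have "\<dots> = (\<Sum>l\<in>S. if l = 1 then h l else 0)"
  proof (rule sum.cong[OF refl])
    fix l assume "l \<in> S"
    \<comment> \<open>\<open>D\<close> contains every divisor of \<open>l\<close>, so the full
      Moebius sum appears.\<close>
    then have "{n. n \<in> D \<and> n dvd l} = {n. n dvd l}"
      by (auto simp: D_def)
    then have "(\<Sum>n | n \<in> D \<and> n dvd l. of_int (moebius_mu n) * h l)
        = of_int (\<Sum>n | n dvd l. moebius_mu n) * h l"
      by (simp add: sum_distrib_right)
    then show "(\<Sum>n | n \<in> D \<and> n dvd l. of_int (moebius_mu n) * h l) = (if l = 1 then h l else 0)"
      using sum_moebius_mu[OF S_pos[OF \<open>l \<in> S\<close>]] by simp
  qed
  \<comment> \<open>\<open>1\<close> is always a common divisor, so it is missing from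
    \<open>S\<close> only if \<open>h 1 = 0\<close>, and the value is \<open>h 1\<close> in either
    case.\<close>
  also have "\<dots> = h 1"
    using S by (auto simp: pos_divisors_def)
  also have "\<dots> = f k m"
    using one vec_div_one[of k] by (simp add: h_def)
  finally show "f k m =
      sum' (\<lambda>n. of_int (moebius_mu n) * \<alpha> n * g (vec_div k n) (n * m)) (pos_divisors k)" ..
qed

end
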